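(* Let $X$ and $Y$ be stochastically independent centered random vectors in $\mathbb{R}^d$, each admitting a density with respect to Lebesgue measure. Suppose that $X$ has score $\rho_X(X)$ and Stein matrix $\tau_X(X)$, and that $Y$ has score $\rho_Y(Y)$ and Stein matrix $\tau_Y(Y)$. For $0<t<1$, let $W_t=\sqrt{t}\,X+\sqrt{1-t}\,Y$ and let $\Gamma_t$ be the covariance matrix of $W_t$. Then, almost surely, $$\rho_{W_t}(W_t)+\Gamma_t^{-1}W_t = E\left[\frac{t}{\sqrt{1-t}}\left(Id-\Gamma_t^{-1}\tau_X(X)\right)\rho_Y(Y)+\frac{1-t}{\sqrt{t}}\left(Id-\Gamma_t^{-1}\tau_Y(Y)\right)\rho_X(X)\,\Big|\,W_t\right],$$ where $\rho_{W_t}(W_t)$ denotes the score of $W_t$; that is, the right-hand side minus $\Gamma_t^{-1}W_t$ is a version of the score of $W_t$.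
   Context: Fix an integer $d\ge 1$. Vectors in $\mathbb{R}^d$ are $d\times 1$ columns, $Id$ is the $d\times d$ identity matrix, and $\nabla$ is the gradient. Random vectors have a finite covariance matrix. The score of a random vector $X$ is the random vector $\rho_X(X)$ (a measurable function of $X$) satisfying $E[\rho_X(X)\varphi(X)]=-E[\nabla\varphi(X)]$ for all real-valued $\varphi\in C_c^\infty(\mathbb{R}^d)$. A Stein matrix of $X$ is any random $d\times d$ matrix $\tau_X(X)$ (a measurable function of $X$) satisfying $E[\tau_X(X)\nabla\varphi(X)]=E[X\varphi(X)]$ for all real-valued $\varphi\in C_c^\infty(\mathbb{R}^d)$. *)

theory Defs
  imports "HOL-Probability.Probability"
begin

definition partial :: "'d::finite \<Rightarrow> (real ^ 'd \<Rightarrow> real) \<Rightarrow> real ^ 'd \<Rightarrow> real" where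
  "partial i f x = frechet_derivative f (at x) (axis i 1)"

definition grad :: "(real ^ 'd::finite \<Rightarrow> real) \<Rightarrow> real ^ 'd \<Rightarrow> real ^ 'd" where
  "grad f x = (\<chi> i. partial i f x)"

primrec Ck :: "nat \<Rightarrow> (real ^ 'd::finite \<Rightarrow> real) \<Rightarrow> bool" where
  "Ck 0 f \<longleftrightarrow> continuous_on UNIV f"
| "Ck (Suc k) f \<longleftrightarrow> (\<forall>x. f differentiable (at x)) \<and> (\<forall>i. Ck k (partial i f))"

definition test_function :: "(real ^ 'd::finite \<Rightarrow> real) \<Rightarrow> bool" where
  "test_function \<phi> \<longleftrightarrow> (\<forall>k. Ck k \<phi>) \<and> compact (closure {x. \<phi> x \<noteq> 0})"

text \<open>
  In the next two definitions the integrability clauses say that the expectations in the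
  defining identities exist; a Bochner integral of a non-integrable function would be zero.
  Global integrability of \<open>\<rho>(X)\<close> or \<open>\<tau>(X)\<close> is not part of the definitions.
\<close>

definition is_score ::
  "'a measure \<Rightarrow> ('a \<Rightarrow> real ^ 'd::finite) \<Rightarrow> (real ^ 'd \<Rightarrow> real ^ 'd) \<Rightarrow> bool" where
  "is_score M X \<rho> \<longleftrightarrow>
     \<rho> \<in> borel_measurable borel \<and>
     (\<forall>\<phi>. test_function \<phi> \<longrightarrow>
        integrable M (\<lambda>\<omega>. \<phi> (X \<omega>) *\<^sub>R \<rho> (X \<omega>)) \<and>
        (\<integral>\<omega>. \<phi> (X \<omega>) *\<^sub>R \<rho> (X \<omega>) \<partial>M) = - (\<integral>\<omega>. grad \<phi> (X \<omega>) \<partial>M))"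

definition is_stein_matrix ::
  "'a measure \<Rightarrow> ('a \<Rightarrow> real ^ 'd::finite) \<Rightarrow> (real ^ 'd \<Rightarrow> real ^ 'd ^ 'd) \<Rightarrow> bool" where
  "is_stein_matrix M X \<tau> \<longleftrightarrow>
     \<tau> \<in> borel_measurable borel \<and>
     (\<forall>\<phi>. test_function \<phi> \<longrightarrow>
        integrable M (\<lambda>\<omega>. \<tau> (X \<omega>) *v grad \<phi> (X \<omega>)) \<and>
        (\<integral>\<omega>. \<tau> (X \<omega>) *v grad \<phi> (X \<omega>) \<partial>M) = (\<integral>\<omega>. \<phi> (X \<omega>) *\<^sub>R X \<omega> \<partial>M))"

definition finite_covariance :: "'a measure \<Rightarrow> ('a \<Rightarrow> real ^ 'd::finite) \<Rightarrow> bool" where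
  "finite_covariance M X \<longleftrightarrow> (\<forall>i. integrable M (\<lambda>\<omega>. (X \<omega> $ i)\<^sup>2))"

definition covariance_matrix ::
  "'a measure \<Rightarrow> ('a \<Rightarrow> real ^ 'd::finite) \<Rightarrow> real ^ 'd ^ 'd" where
  "covariance_matrix M X =
     (\<chi> i j. \<integral>\<omega>. (X \<omega> $ i - (\<integral>\<omega>'. X \<omega>' $ i \<partial>M)) * (X \<omega> $ j - (\<integral>\<omega>'. X \<omega>' $ j \<partial>M)) \<partial>M)"

text \<open>Conditional expectation of a random vector, componentwise, given the
  \<open>\<sigma>\<close>-algebra generated by \<open>W\<close>.\<close>

definition cond_exp_given ::
  "'a measure \<Rightarrow> ('a \<Rightarrow> real ^ 'd::finite) \<Rightarrow> ('a \<Rightarrow> real ^ 'd) \<Rightarrow> 'a \<Rightarrow> real ^ 'd" where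
  "cond_exp_given M W Z \<omega> =
     (\<chi> i. real_cond_exp M (vimage_algebra (space M) W borel) (\<lambda>\<omega>'. Z \<omega>' $ i) \<omega>)"

end

(* Write a = sqrt t, b = sqrt (1 - t). For a test function phi, phi (a x + b y) is a test function in
   each variable, so by Fubini the score of Y gives E[phi(W) rho_Y(Y)] = - b E[grad phi(W)], and the
   score of Y followed by the Stein identity of X gives
   E[phi(W) tau_X(X) rho_Y(Y)] = - b E[tau_X(X) grad phi(W)] = - (b / a) E[phi(W) X].
   Together with the symmetric identities, the variable R inside the conditional expectation satisfies
   E[phi(W) R] = - E[grad phi(W)] + Gamma^{-1} E[phi(W) W]. Hence E[R | W] - Gamma^{-1} W, a function
   of W by the Doob-Dynkin factorisation, is a score of W. Scores are unique almost surely because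
   bump functions built from exp (- 1 / s) converge to the indicators of boxes. *)

theory Submission
  imports Defs
begin

section \<open>Test functions\<close>

text \<open>For nonzero \<open>\<phi>\<close>, the function \<open>\<phi> (a x + b y)\<close> of the
  pair is not compactly supported, since its support is unbounded along the directions where
  \<open>a x + b y\<close> is constant. So each defining identity is applied with one variable
  frozen, and the order of integration is exchanged between the score step and the Stein step. The
  joint integrability behind Fubini comes from the boundedness of \<open>\<phi>\<close> and its
  gradient, and from independence, which makes a product of two merely integrable factors
  integrable. A candidate score of W is known to be integrable only against test functions, so two
  candidates are compared through measures that are finite on boxes but perhaps not globally. The
  weights a^2 / b and b^2 / a are exactly those for which the two gradient terms add up with total
  weight a^2 + b^2 = 1, while the two Stein terms recombine to a X + b Y = W.\<close>

lemma partial_eqI: "(f has_derivative f') (at x) \<Longrightarrow> partial i f x = f' (axis i 1)"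
  unfolding partial_def by (metis frechet_derivative_at)

lemma partial_add:
  "f differentiable at x \<Longrightarrow> g differentiable at x \<Longrightarrow>
    partial i (\<lambda>x. f x + g x) x = partial i f x + partial i g x"
  unfolding partial_def frechet_derivative_works
  by (subst frechet_derivative_at[OF has_derivative_add, symmetric]) auto

lemma partial_mult:
  "f differentiable at x \<Longrightarrow> g differentiable at x \<Longrightarrow>
    partial i (\<lambda>x. f x * g x) x = f x * partial i g x + partial i f x * g x"
  unfolding partial_def frechet_derivative_works
  by (subst frechet_derivative_at[OF has_derivative_mult, symmetric]) auto

lemma partial_const [simp]: "partial i (\<lambda>x. c) = (\<lambda>x. 0)"
  by (rule ext) (simp add: partial_def)

lemma Ck_imp_continuous_on: "Ck k f \<Longrightarrow> continuous_on A f"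
proof (cases k)
  case (Suc j)
  assume "Ck k f"
  then show ?thesis
    using Suc by (auto intro!: continuous_at_imp_continuous_on differentiable_imp_continuous_within)
qed (auto intro: continuous_on_subset)

text \<open>\<open>Ck (Suc k)\<close> does not list continuity of \<open>f\<close> itself; at the
  bottom of the induction it is recovered from differentiability.\<close>

lemma Ck_SucD: "Ck (Suc k) f \<Longrightarrow> Ck k f"
proof (induction k arbitrary: f)
  case 0
  then show ?case using Ck_imp_continuous_on[of "Suc 0" f UNIV] by simp
qed simp

lemma Ck_const: "Ck k (\<lambda>x. c)"
  by (induction k arbitrary: c) auto

lemma Ck_add: "Ck k f \<Longrightarrow> Ck k g \<Longrightarrow> Ck k (\<lambda>x. f x + g x)"
proof (induction k arbitrary: f g)
  case (Suc k)
  then have "partial i (\<lambda>x. f x + g x) = (\<lambda>x. partial i f x + partial i g x)" for i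
    by (auto intro!: ext partial_add)
  with Suc show ?case by auto
qed (auto intro: continuous_intros)

lemma Ck_mult: "Ck k f \<Longrightarrow> Ck k g \<Longrightarrow> Ck k (\<lambda>x. f x * g x)"
proof (induction k arbitrary: f g)
  case (Suc k)
  then have "partial i (\<lambda>x. f x * g x) = (\<lambda>x. f x * partial i g x + partial i f x * g x)" for i
    by (auto intro!: ext partial_mult)
  \<comment> \<open>The product rule also contains the undifferentiated factors, which have to be
    demoted to order \<open>k\<close> before the induction hypothesis applies.\<close>
  moreover have "Ck k f" "Ck k g" using Suc.prems by (auto dest!: Ck_SucD simp del: Ck.simps)
  ultimately show ?case using Suc by (auto intro!: Ck_add)
qed (auto intro: continuous_intros)

lemma Ck_diff: "Ck k f \<Longrightarrow> Ck k g \<Longrightarrow> Ck k (\<lambda>x. f x - g x)"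
  using Ck_add[of k f "\<lambda>x. - 1 * g x"] Ck_mult[OF Ck_const, of k g "- 1"] by simp

lemma Ck_prod: "finite I \<Longrightarrow> (\<And>i. i \<in> I \<Longrightarrow> Ck k (f i)) \<Longrightarrow> Ck k (\<lambda>x. \<Prod>i\<in>I. f i x)"
  by (induction I rule: finite_induct) (auto intro!: Ck_const Ck_mult)

section \<open>Affine changes of variable in test functions\<close>

lemma has_derivative_affine_compose:
  fixes f :: "real ^ 'd::finite \<Rightarrow> real"
  assumes "f differentiable at (v + b *\<^sub>R x)"
  shows "((\<lambda>x. f (v + b *\<^sub>R x)) has_derivative
    (\<lambda>h. frechet_derivative f (at (v + b *\<^sub>R x)) (b *\<^sub>R h))) (at x)"
proof (rule has_derivative_compose[where f="\<lambda>x. v + b *\<^sub>R x"])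
  show "((\<lambda>x. v + b *\<^sub>R x) has_derivative (\<lambda>h. b *\<^sub>R h)) (at x)"
    by (auto intro!: derivative_eq_intros)
  show "(f has_derivative frechet_derivative f (at (v + b *\<^sub>R x))) (at (v + b *\<^sub>R x))"
    using assms frechet_derivative_works by blast
qed

lemma partial_affine_compose:
  fixes f :: "real ^ 'd::finite \<Rightarrow> real"
  assumes "f differentiable at (v + b *\<^sub>R x)"
  shows "partial i (\<lambda>x. f (v + b *\<^sub>R x)) x = b * partial i f (v + b *\<^sub>R x)"
proof -
  have "linear (frechet_derivative f (at (v + b *\<^sub>R x)))"
    using assms linear_frechet_derivative by blast
  then show ?thesis
    using partial_eqI[OF has_derivative_affine_compose[OF assms]]
    by (simp add: partial_def linear_cmul)
qed

lemma Ck_affine_compose: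
  fixes f :: "real ^ 'd::finite \<Rightarrow> real"
  shows "Ck k f \<Longrightarrow> Ck k (\<lambda>x. f (v + b *\<^sub>R x))"
proof (induction k arbitrary: f)
  case 0
  then have "continuous_on UNIV (f \<circ> (\<lambda>x. v + b *\<^sub>R x))"
    by (intro continuous_on_compose continuous_intros) (auto intro: continuous_on_subset)
  then show ?case by (simp add: o_def)
next
  case (Suc k)
  then have "partial i (\<lambda>x. f (v + b *\<^sub>R x)) = (\<lambda>x. b * partial i f (v + b *\<^sub>R x))" for i
    by (auto intro!: ext partial_affine_compose)
  moreover have "(\<lambda>x. f (v + b *\<^sub>R x)) differentiable at x" for x
    using has_derivative_affine_compose[of f v b x] Suc.prems by (auto intro: differentiableI)
  ultimately show ?case using Suc by (auto intro!: Ck_mult Ck_const)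
qed

lemma compact_closure_iff_bounded:
  fixes S :: "'a::heine_borel set"
  shows "compact (closure S) \<longleftrightarrow> bounded S"
  by (metis bounded_closure bounded_subset closure_subset compact_closure)

text \<open>This is the freezing of one variable in \<open>\<phi> (a x + b y)\<close>. The new
  support is the image of the old one under the inverse affine map, hence bounded; for
  \<open>b = 0\<close> the function would be a constant.\<close>

lemma test_function_affine_compose:
  fixes f :: "real ^ 'd::finite \<Rightarrow> real"
  assumes "test_function f" "b \<noteq> 0"
  shows "test_function (\<lambda>x. f (v + b *\<^sub>R x))"
proof -
  have "bounded {x. f x \<noteq> 0}"
    using assms by (simp add: test_function_def compact_closure_iff_bounded)
  then have "bounded ((\<lambda>z. - ((1/b) *\<^sub>R v) + (1/b) *\<^sub>R z) ` {x. f x \<noteq> 0})"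
    by (metis bounded_scaling bounded_translation image_image)
  moreover have "{x. f (v + b *\<^sub>R x) \<noteq> 0} \<subseteq> (\<lambda>z. - ((1/b) *\<^sub>R v) + (1/b) *\<^sub>R z) ` {x. f x \<noteq> 0}"
  proof
    fix x assume "x \<in> {x. f (v + b *\<^sub>R x) \<noteq> 0}"
    moreover have "x = - ((1/b) *\<^sub>R v) + (1/b) *\<^sub>R (v + b *\<^sub>R x)"
      using assms by (simp add: scaleR_add_right)
    ultimately show "x \<in> (\<lambda>z. - ((1/b) *\<^sub>R v) + (1/b) *\<^sub>R z) ` {x. f x \<noteq> 0}"
      by blast
  qed
  ultimately show ?thesis
    using assms bounded_subset
    by (auto simp add: test_function_def compact_closure_iff_bounded intro: Ck_affine_compose)
qed

lemma test_functionD: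
  assumes "test_function f"
  shows "continuous_on UNIV f" "f differentiable at x" "continuous_on UNIV (grad f)"
proof -
  show "continuous_on UNIV f" using assms by (auto simp: test_function_def intro: Ck_imp_continuous_on)
  have 2: "Ck (Suc 0) f" using assms unfolding test_function_def by blast
  then show "f differentiable at x" by simp
  from 2 show "continuous_on UNIV (grad f)"
    unfolding grad_def[abs_def] by (auto intro!: continuous_on_vec_lambda)
qed

lemma grad_affine_compose:
  fixes f :: "real ^ 'd::finite \<Rightarrow> real"
  assumes "test_function f"
  shows "grad (\<lambda>x. f (v + b *\<^sub>R x)) x = b *\<^sub>R grad f (v + b *\<^sub>R x)"
  using partial_affine_compose[OF test_functionD(2)[OF assms]]
  by (simp add: grad_def vec_eq_iff)

section \<open>Bounds for test functions and their gradients\<close>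

lemma bounded_range_of_compact_support:
  fixes f :: "'a::topological_space \<Rightarrow> 'b::real_normed_vector"
  assumes "continuous_on UNIV f" "compact K" "\<And>x. x \<notin> K \<Longrightarrow> f x = 0"
  shows "bounded (range f)"
proof -
  have "bounded (f ` K)"
    using assms by (metis compact_continuous_image compact_imp_bounded continuous_on_subset top_greatest)
  then have "bounded (insert 0 (f ` K))" by simp
  moreover have "range f \<subseteq> insert 0 (f ` K)" using assms(3) by blast
  ultimately show ?thesis using bounded_subset by blast
qed

lemma test_function_bounded:
  fixes f :: "real ^ 'd::finite \<Rightarrow> real"
  assumes "test_function f"
  shows "bounded (range f)" "bounded (range (grad f))"
proof -
  let ?K = "closure {x. f x \<noteq> 0}"
  have K: "compact ?K" using assms unfolding test_function_def by (rule conjunct2)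
  have out: "f x = 0" if "x \<notin> ?K" for x
    using that closure_subset[of "{x. f x \<noteq> 0}"] by auto
  show "bounded (range f)"
    by (rule bounded_range_of_compact_support[OF test_functionD(1)[OF assms] K out])
  have out': "grad f x = 0" if "x \<notin> ?K" for x
  proof -
    \<comment> \<open>Taking the closure of the support makes its complement open, so
      \<open>f\<close> is 0 in a whole neighbourhood of \<open>x\<close> and its derivative vanishes
      too.\<close>
    have "(f has_derivative (\<lambda>h. 0)) (at x)"
    proof (rule has_derivative_transform_within_open[where f="\<lambda>x. 0"])
      show "open (- ?K)" by (simp add: open_Compl)
      show "x \<in> - ?K" using that by blast
      show "0 = f y" if "y \<in> - ?K" for y
        using out[OF ComplD[OF that]] by (rule sym)
    qed (rule has_derivative_const)
    from partial_eqI[OF this] show ?thesis by (simp add: grad_def vec_eq_iff)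
  qed
  show "bounded (range (grad f))"
    by (rule bounded_range_of_compact_support[OF test_functionD(3)[OF assms] K out'])
qed

section \<open>A smooth one-sided cutoff\<close>

text \<open>The family is closed under differentiation up to linear combinations, which makes the
  smoothness of \<open>exp (- 1 / s)\<close> at the origin a plain induction.\<close>

definition flat_exp :: "nat \<Rightarrow> real \<Rightarrow> real" where
  "flat_exp n s = (if 0 < s then exp (- (1 / s)) / s ^ n else 0)"

text \<open>From the right, the substitution of \<open>inverse s\<close> turns this into the
  exponential outgrowing every power at infinity.\<close>

lemma flat_exp_tendsto_0: "(flat_exp n \<longlongrightarrow> 0) (at 0)"
proof -
  have "((\<lambda>s. inverse s ^ n / exp (inverse s)) \<longlongrightarrow> 0) (at_right (0::real))"
    by (rule filterlim_compose[OF tendsto_power_div_exp_0 filterlim_inverse_at_top_right])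
  then have "(flat_exp n \<longlongrightarrow> 0) (at_right 0)"
    by (rule Lim_transform_eventually)
      (auto simp: eventually_at_filter flat_exp_def exp_minus field_simps)
  moreover have "(flat_exp n \<longlongrightarrow> 0) (at_left 0)"
    by (rule tendsto_eventually) (auto simp: eventually_at_filter flat_exp_def)
  ultimately show ?thesis by (simp add: filterlim_split_at)
qed

lemma flat_exp_has_real_derivative:
  "(flat_exp n has_real_derivative flat_exp (n + 2) s - n * flat_exp (n + 1) s) (at s)"
proof -
  consider "s < 0" | "s = 0" | "s > 0" by linarith
  then show ?thesis
  proof cases
    case 1
    have "((\<lambda>s. 0) has_real_derivative 0) (at s)" by simp
    then have "(flat_exp n has_real_derivative 0) (at s)"
      by (rule has_field_derivative_transform_within_open[of _ _ _ "{..<0}"])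
        (use 1 in \<open>auto simp: flat_exp_def\<close>)
    then show ?thesis using 1 by (simp add: flat_exp_def)
  next
    case 2
    \<comment> \<open>The difference quotient of \<open>flat_exp n\<close> at the origin is
      \<open>flat_exp (Suc n)\<close>, so differentiability there is the limit already known one
      index higher.\<close>
    have "((\<lambda>h. (flat_exp n (0 + h) - flat_exp n 0) / h) \<longlongrightarrow> 0) (at 0)"
      by (rule Lim_transform_eventually[OF flat_exp_tendsto_0[of "Suc n"]])
        (auto simp: eventually_at_filter flat_exp_def)
    then show ?thesis using 2 by (simp add: DERIV_def flat_exp_def)
  next
    case 3
    have "((\<lambda>s. exp (- (1 / s))) has_real_derivative exp (- (1 / s)) * (1 / s\<^sup>2)) (at s)"
      using 3 by (auto intro!: derivative_eq_intros simp: power2_eq_square)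
    moreover have "((\<lambda>s. s ^ n) has_real_derivative n * s ^ (n - 1)) (at s)"
      by (auto intro!: derivative_eq_intros)
    ultimately have "((\<lambda>s. exp (- (1 / s)) / s ^ n) has_real_derivative
        (exp (- (1 / s)) * (1 / s\<^sup>2) * s ^ n - exp (- (1 / s)) * (n * s ^ (n - 1))) / (s ^ n * s ^ n)) (at s)"
      using 3 by (intro DERIV_divide) auto
    also have "(exp (- (1 / s)) * (1 / s\<^sup>2) * s ^ n - exp (- (1 / s)) * (n * s ^ (n - 1))) / (s ^ n * s ^ n) =
        flat_exp (n + 2) s - n * flat_exp (n + 1) s"
      \<comment> \<open>For \<open>n = 0\<close> the exponent \<open>n - 1\<close> is truncated to
        0; the factor \<open>n\<close> makes that term vanish anyway, and the case split lets both
        sides be compared.\<close>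
      using 3 by (cases n) (simp_all add: flat_exp_def field_simps power2_eq_square)
    finally have "((\<lambda>s. exp (- (1 / s)) / s ^ n) has_real_derivative
        flat_exp (n + 2) s - n * flat_exp (n + 1) s) (at s)" .
    then show ?thesis
      by (rule has_field_derivative_transform_within_open[of _ _ _ "{0<..}"])
        (use 3 in \<open>auto simp: flat_exp_def\<close>)
  qed
qed

lemma flat_exp_coord_has_derivative:
  fixes x :: "real ^ 'd::finite"
  shows "((\<lambda>x. flat_exp n (c * x $ i + e)) has_derivative
    (\<lambda>h. (c * h $ i) * (flat_exp (n + 2) (c * x $ i + e) - n * flat_exp (n + 1) (c * x $ i + e)))) (at x)"
proof (rule has_derivative_compose[where f="\<lambda>x. c * x $ i + e" and f'="\<lambda>h. c * h $ i" and g="flat_exp n"])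
  show "((\<lambda>x. c * x $ i + e) has_derivative (\<lambda>h. c * h $ i)) (at x)"
    by (auto intro!: derivative_eq_intros bounded_linear_imp_has_derivative bounded_linear_vec_nth)
qed (use flat_exp_has_real_derivative[of n] in \<open>simp add: has_field_derivative_def mult.commute[of _ "_ - _"]\<close>)

text \<open>Allowing \<open>c\<close> of either sign covers the cutoffs at both the lower and the
  upper face of a box. The index \<open>n\<close> varies in the induction because each derivative
  raises it.\<close>

lemma Ck_flat_exp_coord: "Ck k (\<lambda>x :: real ^ 'd::finite. flat_exp n (c * x $ i + e))"
proof (induction k arbitrary: n)
  case 0
  show ?case
    using has_derivative_continuous[OF flat_exp_coord_has_derivative[of n c i e]]
    by (auto intro: continuous_at_imp_continuous_on)
next
  case (Suc k)
  have "partial j (\<lambda>x. flat_exp n (c * x $ i + e)) =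
    (\<lambda>x. (c * axis j 1 $ i) * (flat_exp (n + 2) (c * x $ i + e) - n * flat_exp (n + 1) (c * x $ i + e)))" for j
    by (rule ext) (simp add: partial_eqI[OF flat_exp_coord_has_derivative])
  moreover have "(\<lambda>x. flat_exp n (c * x $ i + e)) differentiable at x" for x :: "real ^ 'd"
    using flat_exp_coord_has_derivative unfolding differentiable_def by blast
  ultimately show ?case using Suc by (auto intro!: Ck_mult Ck_diff Ck_const)
qed

section \<open>Smooth bumps approximating boxes\<close>

text \<open>For every \<open>m > 0\<close> this is positive exactly on the open box;
  \<open>m\<close> only controls how steeply it rises at the faces. The supports therefore stay
  fixed while the values inside tend to 1.\<close>

definition box_bump :: "real \<Rightarrow> real ^ 'd::finite \<Rightarrow> real ^ 'd \<Rightarrow> real ^ 'd \<Rightarrow> real" where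
  "box_bump m u v x = (\<Prod>i\<in>UNIV. flat_exp 0 (m * (x $ i - u $ i)) * flat_exp 0 (m * (v $ i - x $ i)))"

lemma flat_exp_0_bounds: "0 \<le> flat_exp 0 s" "flat_exp 0 s \<le> 1"
  by (auto simp: flat_exp_def)

lemma flat_exp_0_ge: "1 \<le> s \<Longrightarrow> exp (-1) \<le> flat_exp 0 s"
  by (simp add: flat_exp_def)

lemma box_bump_bounds: "0 \<le> box_bump m u v x" "box_bump m u v x \<le> 1"
  unfolding box_bump_def
  by (auto intro!: prod_nonneg prod_le_1 mult_nonneg_nonneg mult_le_one simp: flat_exp_0_bounds)

lemma box_bump_outside:
  assumes "0 < m" "x \<notin> box u v"
  shows "box_bump m u v x = 0"
proof -
  obtain i where "\<not> (u $ i < x $ i \<and> x $ i < v $ i)"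
    using assms by (auto simp: mem_box_cart)
  then have "flat_exp 0 (m * (x $ i - u $ i)) * flat_exp 0 (m * (v $ i - x $ i)) = 0"
    using assms by (auto simp: flat_exp_def zero_less_mult_iff)
  then show ?thesis unfolding box_bump_def by (intro prod_zero) auto
qed

lemma test_function_box_bump:
  assumes "0 < m"
  shows "test_function (box_bump m u v)"
proof -
  have "Ck k (\<lambda>x. \<Prod>i\<in>UNIV. flat_exp 0 (m * x $ i + (- m * u $ i)) * flat_exp 0 ((- m) * x $ i + m * v $ i))" for k
    by (intro Ck_prod Ck_mult Ck_flat_exp_coord) simp
  then have "Ck k (box_bump m u v)" for k
    by (simp add: box_bump_def[abs_def] algebra_simps)
  moreover have "{x. box_bump m u v x \<noteq> 0} \<subseteq> box u v"
    using box_bump_outside[OF assms] by blast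
  then have "bounded {x. box_bump m u v x \<noteq> 0}"
    using bounded_box bounded_subset by blast
  ultimately show ?thesis by (simp add: test_function_def compact_closure_iff_bounded)
qed

lemma box_bump_tendsto_indicator:
  fixes u v :: "real ^ 'd::finite"
  shows "(\<lambda>m. box_bump (Suc m) u v x) \<longlonglongrightarrow> indicator (box u v) x"
proof (cases "x \<in> box u v")
  case True
  have "(\<lambda>m. flat_exp 0 (Suc m * s)) \<longlonglongrightarrow> 1" if "s > 0" for s :: real
  proof -
    have "(\<lambda>m. exp (- (inverse s * inverse (Suc m)))) \<longlonglongrightarrow> exp (- (inverse s * 0))"
      by (intro tendsto_intros LIMSEQ_inverse_real_of_nat)
    moreover have "flat_exp 0 (Suc m * s) = exp (- (inverse s * inverse (Suc m)))" for m
      using that by (simp add: flat_exp_def divide_inverse mult.commute del: of_nat_Suc)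
    ultimately show ?thesis by simp
  qed
  then have *: "(\<lambda>m. flat_exp 0 (Suc m * (x $ i - u $ i)) * flat_exp 0 (Suc m * (v $ i - x $ i))) \<longlonglongrightarrow> 1 * 1" for i
    using True by (intro tendsto_mult) (auto simp: mem_box_cart)
  have "(\<lambda>m. box_bump (Suc m) u v x) \<longlonglongrightarrow> (\<Prod>i\<in>(UNIV :: 'd set). 1 * 1)"
    unfolding box_bump_def by (intro Limits.tendsto_prod *)
  then show ?thesis using True by simp
next
  case False
  then show ?thesis by (simp add: box_bump_outside del: of_nat_Suc)
qed

text \<open>Enlarging the box by 1 on every side leaves a distance of at least 1 to each of its 2d
  faces, so each of the 2d cutoff factors is at least its value \<open>exp (-1)\<close> at distance
  1.\<close>

lemma box_bump_ge:
  fixes u v :: "real ^ 'd::finite"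
  assumes "x \<in> box u v"
  shows "exp (-1) ^ (2 * CARD('d)) \<le> box_bump 1 (u - 1) (v + 1) x"
proof -
  have "(\<Prod>i\<in>(UNIV :: 'd set). exp (-1) * exp (-1 :: real)) \<le> box_bump 1 (u - 1) (v + 1) x"
    unfolding box_bump_def
    using assms by (intro prod_mono conjI mult_mono flat_exp_0_ge) (auto simp: mem_box_cart flat_exp_0_bounds less_imp_le add_increasing)
  then show ?thesis by (simp add: power_mult power2_eq_square power_mult_distrib)
qed

section \<open>Functions orthogonal to all test functions\<close>

text \<open>The positive and negative parts of \<open>h\<close> define two measures that are finite
  and equal on boxes. Boxes are stable under intersection, generate the Borel sets and exhaust the
  space, so the measures coincide, and uniqueness of densities makes the two parts equal almost
  everywhere.\<close>

lemma AE_zero_if_test_integrals_zero: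
  fixes h :: "real ^ 'd::finite \<Rightarrow> real"
  assumes "finite_measure \<mu>" and sets: "sets \<mu> = sets borel"
    and h[measurable]: "h \<in> borel_measurable borel"
    and int: "\<And>\<phi>. test_function \<phi> \<Longrightarrow> integrable \<mu> (\<lambda>x. \<phi> x * h x)"
    and zero: "\<And>\<phi>. test_function \<phi> \<Longrightarrow> (\<integral>x. \<phi> x * h x \<partial>\<mu>) = 0"
  shows "AE x in \<mu>. h x = 0"
proof -
  interpret finite_measure \<mu> by fact
  note sets[measurable_cong]
  define c where "c = exp (-1 :: real) ^ (2 * CARD('d))"
  have "c > 0" by (simp add: c_def)
  \<comment> \<open>\<open>h\<close> is only locally integrable: dominate the indicator of a box by a multiple of the bump of a larger box.\<close>
  have int_box: "integrable \<mu> (\<lambda>x. indicator (box u v) x * h x)" for u v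
  proof (rule Bochner_Integration.integrable_bound)
    show "integrable \<mu> (\<lambda>x. (1 / c) * (box_bump 1 (u - 1) (v + 1) x * h x))"
      by (intro integrable_mult_right int test_function_box_bump) simp
    show "AE x in \<mu>. norm (indicator (box u v) x * h x) \<le> norm ((1 / c) * (box_bump 1 (u - 1) (v + 1) x * h x))"
    proof (rule AE_I2)
      fix x
      have "indicator (box u v) x \<le> (1 / c) * box_bump 1 (u - 1) (v + 1) x"
        using box_bump_ge[of x u v] \<open>c > 0\<close> box_bump_bounds(1)[of 1 "u - 1" "v + 1" x]
        by (auto simp: c_def indicator_def field_simps)
      then have "indicator (box u v) x * \<bar>h x\<bar> \<le> (1 / c) * box_bump 1 (u - 1) (v + 1) x * \<bar>h x\<bar>"
        by (intro mult_right_mono) auto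
      then show "norm (indicator (box u v) x * h x) \<le> norm ((1 / c) * (box_bump 1 (u - 1) (v + 1) x * h x))"
        using \<open>c > 0\<close> box_bump_bounds(1)[of 1 "u - 1" "v + 1" x] by (simp add: abs_mult)
    qed
  qed measurable
  have meas_bump: "box_bump (Suc m) u v \<in> borel_measurable borel" for m and u v :: "real ^ 'd"
    by (intro borel_measurable_continuous_onI test_functionD(1) test_function_box_bump) simp
  have zero_box: "(\<integral>x. indicator (box u v) x * h x \<partial>\<mu>) = 0" for u v
  proof (rule LIMSEQ_unique)
    \<comment> \<open>The bumps vanish off \<open>box u v\<close> and are at most 1, so the limit
      function itself, in norm, dominates the sequence.\<close>
    show "(\<lambda>m. \<integral>x. box_bump (Suc m) u v x * h x \<partial>\<mu>) \<longlonglongrightarrow> (\<integral>x. indicator (box u v) x * h x \<partial>\<mu>)"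
    proof (rule integral_dominated_convergence)
      show "integrable \<mu> (\<lambda>x. norm (indicator (box u v) x * h x))"
        using int_box by (rule integrable_norm)
      show "AE x in \<mu>. (\<lambda>m. box_bump (Suc m) u v x * h x) \<longlonglongrightarrow> indicator (box u v) x * h x"
        by (intro AE_I2 tendsto_mult_right box_bump_tendsto_indicator)
      show "AE x in \<mu>. norm (box_bump (Suc m) u v x * h x) \<le> norm (indicator (box u v) x * h x)" for m
        using box_bump_bounds[of "Suc m" u v] box_bump_outside[of "Suc m" _ u v]
        by (intro AE_I2) (auto simp: indicator_def abs_mult mult_left_le_one_le simp del: of_nat_Suc)
    qed (use meas_bump in measurable)
    show "(\<lambda>m. \<integral>x. box_bump (Suc m) u v x * h x \<partial>\<mu>) \<longlonglongrightarrow> 0"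
      by (simp add: zero test_function_box_bump del: of_nat_Suc)
  qed
  \<comment> \<open>\<open>ennreal\<close> sends negative reals to 0, so these densities are the
    positive and the negative part of \<open>h\<close>.\<close>
  define P where "P = density \<mu> (\<lambda>x. ennreal (h x))"
  define N where "N = density \<mu> (\<lambda>x. ennreal (- h x))"
  have eP: "emeasure P (box u v) = (\<integral>\<^sup>+x. ennreal (indicator (box u v) x * h x) \<partial>\<mu>)" for u v
    unfolding P_def by (subst emeasure_density) (auto intro!: nn_integral_cong simp: indicator_def)
  have eN: "emeasure N (box u v) = (\<integral>\<^sup>+x. ennreal (- (indicator (box u v) x * h x)) \<partial>\<mu>)" for u v
    unfolding N_def by (subst emeasure_density) (auto intro!: nn_integral_cong simp: indicator_def)
  have fin: "emeasure P (box u v) \<noteq> \<infinity>" "emeasure N (box u v) \<noteq> \<infinity>" for u v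
    using int_box[of u v] unfolding eP eN real_integrable_def by auto
  have "P = N"
  proof (rule measure_eqI_generator_eq)
    let ?E = "range (\<lambda>(a, b). box a b :: (real ^ 'd) set)"
    show "Int_stable ?E"
      by (auto simp: Int_stable_def box_Int_box)
    show "?E \<subseteq> Pow UNIV" "sets P = sigma_sets UNIV ?E" "sets N = sigma_sets UNIV ?E"
      by (simp_all add: borel_eq_box sets P_def N_def)
    let ?A = "\<lambda>n::nat. box (- (real n *\<^sub>R One)) (real n *\<^sub>R One) :: (real ^ 'd) set"
    show "range ?A \<subseteq> ?E" "(\<Union>i. ?A i) = UNIV"
      unfolding UN_box_eq_UNIV by auto
    show "emeasure P (?A i) \<noteq> \<infinity>" for i by (rule fin)
    show "emeasure P S = emeasure N S" if S: "S \<in> ?E" for S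
    proof -
      obtain u v where S: "S = box u v" using S by auto
      \<comment> \<open>The Bochner integral over the box is the difference of these two numbers,
        and it is 0; finiteness then lifts the equality back to \<open>ennreal\<close>.\<close>
      have "enn2real (emeasure P S) = enn2real (emeasure N S)"
        using real_lebesgue_integral_def[OF int_box[of u v]] zero_box[of u v]
        unfolding S eP eN by simp
      then show ?thesis using fin[of u v] unfolding S
        by (metis ennreal_enn2real infinity_ennreal_def top.not_eq_extremum)
    qed
  qed
  then have "AE x in \<mu>. ennreal (h x) = ennreal (- h x)"
    unfolding P_def N_def by (subst density_unique_iff[symmetric]) auto
  then show ?thesis
  proof eventually_elim
    case (elim x)
    then show ?case by (cases "h x" "0 :: real" rule: linorder_cases) (auto simp: ennreal_neg)
  qed
qed

section \<open>Measurability, integrability and independence\<close>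

text \<open>In finite dimension bilinearity is enough. Boundedness supplies both the continuity
  behind the measurability rule and the constant \<open>K\<close> of the later norm
  estimates.\<close>

lemma bounded_bilinear_matrix_vector_mult:
  "bounded_bilinear ((*v) :: real ^ 'n::finite ^ 'm::finite \<Rightarrow> real ^ 'n \<Rightarrow> real ^ 'm)"
  unfolding bilinear_conv_bounded_bilinear[symmetric] bilinear_def
  by (auto intro!: linearI simp: vec_eq_iff matrix_vector_mult_def sum.distrib sum_distrib_left algebra_simps)

lemma borel_measurable_matrix_vector_mult [measurable (raw)]:
  fixes A :: "'a \<Rightarrow> real ^ 'n::finite ^ 'm::finite"
  assumes "A \<in> borel_measurable M" "x \<in> borel_measurable M"
  shows "(\<lambda>\<omega>. A \<omega> *v x \<omega>) \<in> borel_measurable M"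
  using assms
  by (rule borel_measurable_continuous_Pair)
    (intro bounded_bilinear.continuous_on[OF bounded_bilinear_matrix_vector_mult] continuous_intros)

section \<open>Doob-Dynkin factorisation\<close>

text \<open>The sets of the pulled-back algebra are exactly the preimages under \<open>W\<close>, so
  indicators factor; multiples, sums and countable suprema preserve factoring. In
  \<open>ennreal\<close> the suprema of the factors exist even off the image of \<open>W\<close>,
  where nothing controls them.\<close>

lemma factor_through_vimage_algebra_ennreal:
  fixes f :: "'a \<Rightarrow> ennreal"
  assumes W: "W \<in> \<Omega> \<rightarrow> space N" and f: "f \<in> borel_measurable (vimage_algebra \<Omega> W N)"
  shows "\<exists>g \<in> borel_measurable N. \<forall>\<omega>\<in>\<Omega>. f \<omega> = g (W \<omega>)"
  using f
proof (induction rule: borel_measurable_induct)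
  case (cong f g)
  then show ?case by simp
next
  case (set A)
  then obtain B where "B \<in> sets N" "A = W -` B \<inter> \<Omega>"
    by (auto simp: sets_vimage_algebra2[OF W])
  then show ?case by (intro bexI[of _ "indicator B"]) (auto simp: indicator_def)
next
  case (mult u c)
  then obtain g where "g \<in> borel_measurable N" "\<forall>\<omega>\<in>\<Omega>. u \<omega> = g (W \<omega>)" by blast
  then show ?case by (intro bexI[of _ "\<lambda>x. c * g x"]) auto
next
  case (add u v)
  then obtain g g' where "g \<in> borel_measurable N" "\<forall>\<omega>\<in>\<Omega>. u \<omega> = g (W \<omega>)"
    "g' \<in> borel_measurable N" "\<forall>\<omega>\<in>\<Omega>. v \<omega> = g' (W \<omega>)" by blast
  then show ?case by (intro bexI[of _ "\<lambda>x. g' x + g x"]) auto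
next
  case (seq U)
  then have "\<forall>i. \<exists>g. g \<in> borel_measurable N \<and> (\<forall>\<omega>\<in>\<Omega>. U i \<omega> = g (W \<omega>))" by blast
  then obtain G where "\<And>i. G i \<in> borel_measurable N" "\<And>i \<omega>. \<omega> \<in> \<Omega> \<Longrightarrow> U i \<omega> = G i (W \<omega>)"
    by metis
  then show ?case
    by (intro bexI[of _ "\<lambda>x. SUP i. G i x"]) (auto simp: Sup_apply image_image)
qed

text \<open>The positive and negative parts factor separately. Off the image of \<open>W\<close>
  their factors may be infinite, and \<open>enn2real\<close> keeps the difference real-valued
  there.\<close>

lemma factor_through_vimage_algebra_real:
  fixes f :: "'a \<Rightarrow> real"
  assumes W: "W \<in> \<Omega> \<rightarrow> space N" and f: "f \<in> borel_measurable (vimage_algebra \<Omega> W N)"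
  shows "\<exists>g \<in> borel_measurable N. \<forall>\<omega>\<in>\<Omega>. f \<omega> = g (W \<omega>)"
proof -
  obtain p where p: "p \<in> borel_measurable N" "\<forall>\<omega>\<in>\<Omega>. ennreal (f \<omega>) = p (W \<omega>)"
    using factor_through_vimage_algebra_ennreal[OF W, of "\<lambda>\<omega>. ennreal (f \<omega>)"] f by auto
  obtain n where n: "n \<in> borel_measurable N" "\<forall>\<omega>\<in>\<Omega>. ennreal (- f \<omega>) = n (W \<omega>)"
    using factor_through_vimage_algebra_ennreal[OF W, of "\<lambda>\<omega>. ennreal (- f \<omega>)"] f by auto
  have "f \<omega> = enn2real (p (W \<omega>)) - enn2real (n (W \<omega>))" if "\<omega> \<in> \<Omega>" for \<omega>
    using p(2)[rule_format, OF that, symmetric] n(2)[rule_format, OF that, symmetric]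
    by (cases "0 \<le> f \<omega>") (auto simp: ennreal_neg)
  then show ?thesis
    using p(1) n(1) by (intro bexI[of _ "\<lambda>x. enn2real (p x) - enn2real (n x)"]) auto
qed

section \<open>Vector-valued functions by coordinates\<close>

lemma integrable_vec_iff:
  fixes f :: "'a \<Rightarrow> 'b::euclidean_space ^ 'n::finite"
  shows "integrable M f \<longleftrightarrow> (\<forall>i. integrable M (\<lambda>\<omega>. f \<omega> $ i))"
proof
  have "bounded_linear (axis i :: 'b \<Rightarrow> 'b ^ 'n)" for i
    unfolding linear_conv_bounded_linear[symmetric] by (auto intro!: linearI simp: axis_def vec_eq_iff)
  moreover assume "\<forall>i. integrable M (\<lambda>\<omega>. f \<omega> $ i)"
  ultimately have "integrable M (\<lambda>\<omega>. \<Sum>i\<in>UNIV. axis i (f \<omega> $ i))"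
    by (intro Bochner_Integration.integrable_sum) (rule integrable_bounded_linear[of "axis _"], auto)
  moreover have "(\<Sum>i\<in>UNIV. axis i (f \<omega> $ i)) = f \<omega>" for \<omega>
    by (simp add: vec_eq_iff axis_def if_distrib cong: if_cong)
  ultimately show "integrable M f" by simp
qed (auto intro: integrable_bounded_linear[OF bounded_linear_vec_nth])

lemma integral_vec_nth:
  fixes f :: "'a \<Rightarrow> 'b::euclidean_space ^ 'n::finite"
  shows "integrable M f \<Longrightarrow> (\<integral>\<omega>. f \<omega> $ i \<partial>M) = (\<integral>\<omega>. f \<omega> \<partial>M) $ i"
  by (rule integral_bounded_linear[OF bounded_linear_vec_nth])

lemma borel_measurable_vec_nth_iff:
  fixes f :: "'a \<Rightarrow> real ^ 'n::finite"
  shows "f \<in> borel_measurable M \<longleftrightarrow> (\<forall>i. (\<lambda>\<omega>. f \<omega> $ i) \<in> borel_measurable M)"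
  by (subst borel_measurable_euclidean_space)
    (auto simp: Basis_vec_def inner_axis)

section \<open>Independence and Fubini\<close>

text \<open>With this, each identity is proved once and then applied with the roles of X and Y
  exchanged.\<close>

lemma (in prob_space) indep_var_commute: "indep_var S X T Y \<Longrightarrow> indep_var T Y S X"
  unfolding indep_var_distribution_eq
proof safe
  assume [measurable]: "random_variable S X" "random_variable T Y"
    and eq: "distr M S X \<Otimes>\<^sub>M distr M T Y = distr M (S \<Otimes>\<^sub>M T) (\<lambda>x. (X x, Y x))"
  interpret DX: prob_space "distr M S X" by (rule prob_space_distr) fact
  interpret DY: prob_space "distr M T Y" by (rule prob_space_distr) fact
  interpret pair_sigma_finite "distr M T Y" "distr M S X" ..
  show "distr M T Y \<Otimes>\<^sub>M distr M S X = distr M (T \<Otimes>\<^sub>M S) (\<lambda>x. (Y x, X x))"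
    by (subst distr_pair_swap, subst eq, subst distr_distr) (auto simp: comp_def intro!: distr_cong)
qed

text \<open>Independence makes the joint law the product of the marginals. Both iterated integrals
  are stated over \<open>M\<close> itself, so that the inner one is an expectation in a single
  random vector with the other frozen, the form to which \<open>is_score\<close> and
  \<open>is_stein_matrix\<close> apply.\<close>

lemma (in prob_space) indep_var_Fubini:
  fixes g :: "'b \<Rightarrow> 'b \<Rightarrow> 'e::{banach, second_countable_topology}"
  assumes ind: "indep_var S X T Y"
    and g[measurable]: "case_prod g \<in> borel_measurable (S \<Otimes>\<^sub>M T)"
    and int: "integrable M (\<lambda>\<omega>. g (X \<omega>) (Y \<omega>))"
  shows "(\<integral>\<omega>. g (X \<omega>) (Y \<omega>) \<partial>M) = (\<integral>\<omega>. (\<integral>\<omega>'. g (X \<omega>) (Y \<omega>') \<partial>M) \<partial>M)"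
    and "(\<integral>\<omega>. g (X \<omega>) (Y \<omega>) \<partial>M) = (\<integral>\<omega>'. (\<integral>\<omega>. g (X \<omega>) (Y \<omega>') \<partial>M) \<partial>M)"
proof -
  have X[measurable]: "X \<in> M \<rightarrow>\<^sub>M S" and Y[measurable]: "Y \<in> M \<rightarrow>\<^sub>M T"
    and eq: "distr M S X \<Otimes>\<^sub>M distr M T Y = distr M (S \<Otimes>\<^sub>M T) (\<lambda>x. (X x, Y x))"
    using ind unfolding indep_var_distribution_eq by auto
  interpret DX: prob_space "distr M S X" by (rule prob_space_distr) fact
  interpret DY: prob_space "distr M T Y" by (rule prob_space_distr) fact
  interpret pair_sigma_finite "distr M S X" "distr M T Y" ..
  have int': "integrable (distr M S X \<Otimes>\<^sub>M distr M T Y) (case_prod g)"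
    unfolding eq using int by (subst integrable_distr_eq) auto
  have E: "(\<integral>\<omega>. g (X \<omega>) (Y \<omega>) \<partial>M) = integral\<^sup>L (distr M S X \<Otimes>\<^sub>M distr M T Y) (case_prod g)"
    unfolding eq by (subst integral_distr) auto
  have gX: "(\<lambda>y. g x y) \<in> borel_measurable T" if "x \<in> space S" for x
    using measurable_Pair2[OF g that] by simp
  have gY: "(\<lambda>x. g x y) \<in> borel_measurable S" if "y \<in> space T" for y
    using measurable_Pair1[OF g that] by simp
  have "(\<lambda>x. \<integral>y. g x y \<partial>distr M T Y) \<in> borel_measurable S"
    by (rule DY.borel_measurable_lebesgue_integral) simp
  then have "(\<integral>x. (\<integral>y. g x y \<partial>distr M T Y) \<partial>distr M S X) = (\<integral>\<omega>. (\<integral>y. g (X \<omega>) y \<partial>distr M T Y) \<partial>M)"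
    by (subst integral_distr) auto
  also have "\<dots> = (\<integral>\<omega>. (\<integral>\<omega>'. g (X \<omega>) (Y \<omega>') \<partial>M) \<partial>M)"
    by (intro Bochner_Integration.integral_cong refl integral_distr Y gX measurable_space[OF X])
  finally show "(\<integral>\<omega>. g (X \<omega>) (Y \<omega>) \<partial>M) = (\<integral>\<omega>. (\<integral>\<omega>'. g (X \<omega>) (Y \<omega>') \<partial>M) \<partial>M)"
    using E integral_fst[OF int'] by simp
  have "(\<lambda>y. \<integral>x. g x y \<partial>distr M S X) \<in> borel_measurable T"
    by (rule DX.borel_measurable_lebesgue_integral) measurable
  then have "(\<integral>y. (\<integral>x. g x y \<partial>distr M S X) \<partial>distr M T Y) = (\<integral>\<omega>. (\<integral>x. g x (Y \<omega>) \<partial>distr M S X) \<partial>M)"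
    by (subst integral_distr) auto
  also have "\<dots> = (\<integral>\<omega>'. (\<integral>\<omega>. g (X \<omega>) (Y \<omega>') \<partial>M) \<partial>M)"
    by (intro Bochner_Integration.integral_cong refl integral_distr X gY measurable_space[OF Y])
  finally show "(\<integral>\<omega>. g (X \<omega>) (Y \<omega>) \<partial>M) = (\<integral>\<omega>'. (\<integral>\<omega>. g (X \<omega>) (Y \<omega>') \<partial>M) \<partial>M)"
    using E integral_snd[OF int'] by simp
qed

text \<open>Only first moments are given, so Cauchy-Schwarz is out of reach; independence makes the
  product of the norms integrable, and that product times \<open>K\<close> dominates.\<close>

lemma (in prob_space) integrable_indep_matrix_vector_mult:
  fixes A :: "'b \<Rightarrow> real ^ 'n::finite ^ 'm::finite"
  assumes ind: "indep_var S X T Y" and [measurable]: "A \<in> borel_measurable S" "v \<in> borel_measurable T"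
    and int: "integrable M (\<lambda>\<omega>. A (X \<omega>))" "integrable M (\<lambda>\<omega>. v (Y \<omega>))"
  shows "integrable M (\<lambda>\<omega>. A (X \<omega>) *v v (Y \<omega>))"
proof -
  obtain K where K: "\<And>(A :: real ^ 'n ^ 'm) x. norm (A *v x) \<le> norm A * norm x * K"
    using bounded_bilinear.bounded[OF bounded_bilinear_matrix_vector_mult] by blast
  have [measurable]: "X \<in> M \<rightarrow>\<^sub>M S" "Y \<in> M \<rightarrow>\<^sub>M T"
    using ind by (auto dest: indep_var_rv1 indep_var_rv2)
  have "indep_var borel ((\<lambda>x. norm (A x)) \<circ> X) borel ((\<lambda>y. norm (v y)) \<circ> Y)"
    using ind by (rule indep_var_compose) auto
  then have "integrable M (\<lambda>\<omega>. norm (A (X \<omega>)) * norm (v (Y \<omega>)))"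
    using int by (intro indep_var_integrable) (auto simp: o_def)
  then have "integrable M (\<lambda>\<omega>. norm (A (X \<omega>)) * norm (v (Y \<omega>)) * K)"
    by simp
  then show ?thesis
    by (rule Bochner_Integration.integrable_bound)
      (auto intro!: AE_I2 order_trans[OF K] abs_ge_self)
qed

lemma (in prob_space) integrable_test_function_scaleR:
  fixes Z :: "'a \<Rightarrow> 'b::{banach, second_countable_topology}" and W :: "'a \<Rightarrow> real ^ 'd::finite"
  assumes \<phi>: "test_function \<phi>" and W: "random_variable borel W" and Z: "integrable M Z"
  shows "integrable M (\<lambda>\<omega>. \<phi> (W \<omega>) *\<^sub>R Z \<omega>)"
proof -
  obtain B where B: "\<And>x. \<bar>\<phi> x\<bar> \<le> B"
    using test_function_bounded(1)[OF \<phi>] by (auto simp: bounded_iff)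
  have [measurable]: "\<phi> \<in> borel_measurable borel"
    using test_functionD(1)[OF \<phi>] by (rule borel_measurable_continuous_onI)
  note W[measurable]
  have "integrable M (\<lambda>\<omega>. B *\<^sub>R Z \<omega>)" using Z by simp
  then show ?thesis
    by (rule Bochner_Integration.integrable_bound)
      (use Z in \<open>auto intro!: AE_I2 mult_right_mono order_trans[OF B]\<close>)
qed

lemma (in prob_space) integrable_grad_test_function:
  fixes W :: "'a \<Rightarrow> real ^ 'd::finite"
  assumes \<phi>: "test_function \<phi>" and W: "random_variable borel W"
  shows "integrable M (\<lambda>\<omega>. grad \<phi> (W \<omega>))"
proof -
  obtain B where "\<And>x. norm (grad \<phi> x) \<le> B"
    using test_function_bounded(2)[OF \<phi>] by (auto simp: bounded_iff)
  moreover have "grad \<phi> \<in> borel_measurable borel"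
    using test_functionD(3)[OF \<phi>] by (rule borel_measurable_continuous_onI)
  ultimately show ?thesis
    using W by (intro integrable_const_bound[of _ B]) auto
qed

lemma (in prob_space) integrable_if_finite_covariance:
  assumes "finite_covariance M X" "random_variable borel X"
  shows "integrable M X"
  unfolding integrable_vec_iff
proof
  fix i
  show "integrable M (\<lambda>\<omega>. X \<omega> $ i)"
  proof (rule Bochner_Integration.integrable_bound)
    show "integrable M (\<lambda>\<omega>. 1 + (X \<omega> $ i)\<^sup>2)"
      using assms by (auto simp: finite_covariance_def)
    show "AE \<omega> in M. norm (X \<omega> $ i) \<le> norm (1 + (X \<omega> $ i)\<^sup>2)"
    proof (rule AE_I2)
      fix \<omega>
      \<comment> \<open>Expanding the square gives 2 |x| \<le> 1 + x^2, which is stronger than the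
        bound wanted.\<close>
      have "0 \<le> (\<bar>X \<omega> $ i\<bar> - 1)\<^sup>2" by simp
      then show "norm (X \<omega> $ i) \<le> norm (1 + (X \<omega> $ i)\<^sup>2)"
        by (simp add: power2_diff)
    qed
    have "(\<lambda>x. x $ i) \<in> borel_measurable borel"
      by (intro borel_measurable_continuous_onI continuous_intros)
    then show "(\<lambda>\<omega>. X \<omega> $ i) \<in> borel_measurable M"
      using assms(2) by (rule measurable_compose[rotated])
  qed
qed

section \<open>Scores and Stein matrices\<close>

lemma is_scoreD:
  assumes "is_score M X \<rho>" "test_function \<phi>"
  shows "(\<integral>\<omega>. \<phi> (X \<omega>) *\<^sub>R \<rho> (X \<omega>) \<partial>M) = - (\<integral>\<omega>. grad \<phi> (X \<omega>) \<partial>M)"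
  using assms unfolding is_score_def by blast

lemma is_stein_matrixD:
  assumes "is_stein_matrix M X \<tau>" "test_function \<phi>"
  shows "(\<integral>\<omega>. \<tau> (X \<omega>) *v grad \<phi> (X \<omega>) \<partial>M) = (\<integral>\<omega>. \<phi> (X \<omega>) *\<^sub>R X \<omega> \<partial>M)"
  using assms unfolding is_stein_matrix_def by blast

section \<open>Almost sure uniqueness of the score\<close>

text \<open>Each coordinate of the difference of two scores is a function on the target space
  orthogonal to all test functions under the law of \<open>W\<close>, so it vanishes almost
  everywhere for that law.\<close>

lemma (in prob_space) is_score_unique:
  fixes W :: "'a \<Rightarrow> real ^ 'd::finite"
  assumes W[measurable]: "random_variable borel W" and "is_score M W \<rho>" "is_score M W \<rho>'"
  shows "AE \<omega> in M. \<rho> (W \<omega>) = \<rho>' (W \<omega>)"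
proof -
  have [measurable]: "\<rho> \<in> borel_measurable borel" "\<rho>' \<in> borel_measurable borel"
    using assms by (auto simp: is_score_def)
  have "AE \<omega> in M. \<rho> (W \<omega>) $ i - \<rho>' (W \<omega>) $ i = 0" for i
  proof -
    have [measurable]: "(\<lambda>x. \<rho> x $ i) \<in> borel_measurable borel" "(\<lambda>x. \<rho>' x $ i) \<in> borel_measurable borel"
      by (rule iffD1[OF borel_measurable_vec_nth_iff, rule_format], measurable)+
    have "AE x in distr M borel W. \<rho> x $ i - \<rho>' x $ i = 0"
    proof (rule AE_zero_if_test_integrals_zero)
      show "finite_measure (distr M borel W)"
        using prob_space_distr[OF W] prob_space_def by blast
      fix \<phi> :: "real ^ 'd \<Rightarrow> real"
      assume \<phi>: "test_function \<phi>"
      have [measurable]: "\<phi> \<in> borel_measurable borel"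
        using test_functionD(1)[OF \<phi>] by (rule borel_measurable_continuous_onI)
      have int: "integrable M (\<lambda>\<omega>. \<phi> (W \<omega>) *\<^sub>R \<rho> (W \<omega>))" "integrable M (\<lambda>\<omega>. \<phi> (W \<omega>) *\<^sub>R \<rho>' (W \<omega>))"
        and eq: "(\<integral>\<omega>. \<phi> (W \<omega>) *\<^sub>R \<rho> (W \<omega>) \<partial>M) = (\<integral>\<omega>. \<phi> (W \<omega>) *\<^sub>R \<rho>' (W \<omega>) \<partial>M)"
        using assms \<phi> by (auto simp: is_score_def)
      have int_i: "integrable M (\<lambda>\<omega>. \<phi> (W \<omega>) * \<rho> (W \<omega>) $ i)" "integrable M (\<lambda>\<omega>. \<phi> (W \<omega>) * \<rho>' (W \<omega>) $ i)"
        using int unfolding integrable_vec_iff by auto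
      have eq_i: "(\<integral>\<omega>. \<phi> (W \<omega>) * \<rho> (W \<omega>) $ i \<partial>M) = (\<integral>\<omega>. \<phi> (W \<omega>) * \<rho>' (W \<omega>) $ i \<partial>M)"
        using integral_vec_nth[OF int(1), of i] integral_vec_nth[OF int(2), of i] eq by simp
      have "integrable M (\<lambda>\<omega>. \<phi> (W \<omega>) * (\<rho> (W \<omega>) $ i - \<rho>' (W \<omega>) $ i))"
        using Bochner_Integration.integrable_diff[OF int_i] by (simp add: right_diff_distrib)
      then show "integrable (distr M borel W) (\<lambda>x. \<phi> x * (\<rho> x $ i - \<rho>' x $ i))"
        by (subst integrable_distr_eq) auto
      have "(\<integral>\<omega>. \<phi> (W \<omega>) * (\<rho> (W \<omega>) $ i - \<rho>' (W \<omega>) $ i) \<partial>M) = 0"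
        using Bochner_Integration.integral_diff[OF int_i] eq_i by (simp add: right_diff_distrib)
      then show "(\<integral>x. \<phi> x * (\<rho> x $ i - \<rho>' x $ i) \<partial>distr M borel W) = 0"
        by (subst integral_distr) auto
    qed auto
    then show ?thesis by (subst (asm) AE_distr_iff) auto
  qed
  then have "AE \<omega> in M. \<forall>i. \<rho> (W \<omega>) $ i - \<rho>' (W \<omega>) $ i = 0"
    by (simp add: AE_all_countable)
  then show ?thesis by eventually_elim (simp add: vec_eq_iff)
qed

section \<open>Conditional expectation as a function of \<open>W\<close>\<close>

text \<open>A score is a function on the target space, whereas a conditional expectation lives on
  the sample space; \<open>g\<close> bridges the two. Testing \<open>g (W \<omega>)\<close> against
  \<open>\<phi> (W \<omega>)\<close> gives the same as testing \<open>Z\<close>, by the pull-out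
  property.\<close>

lemma (in prob_space) cond_exp_given_factor:
  fixes W :: "'a \<Rightarrow> real ^ 'd::finite" and Z :: "'a \<Rightarrow> real ^ 'd"
  assumes W[measurable]: "random_variable borel W" and Z: "integrable M Z"
  obtains g where "g \<in> borel_measurable borel"
    "\<And>\<omega>. \<omega> \<in> space M \<Longrightarrow> cond_exp_given M W Z \<omega> = g (W \<omega>)"
    "\<And>\<phi>. test_function \<phi> \<Longrightarrow> integrable M (\<lambda>\<omega>. \<phi> (W \<omega>) *\<^sub>R g (W \<omega>))"
    "\<And>\<phi>. test_function \<phi> \<Longrightarrow>
      (\<integral>\<omega>. \<phi> (W \<omega>) *\<^sub>R g (W \<omega>) \<partial>M) = (\<integral>\<omega>. \<phi> (W \<omega>) *\<^sub>R Z \<omega> \<partial>M)"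
proof -
  define F where "F = vimage_algebra (space M) W borel"
  have "subalgebra M F"
    unfolding subalgebra_def F_def
    using W by (auto simp: sets_vimage_algebra2 intro: measurable_sets)
  then interpret finite_measure_subalgebra M F
    by unfold_locales
  have WF[measurable]: "W \<in> F \<rightarrow>\<^sub>M borel"
    unfolding F_def by (rule measurable_vimage_algebra1) simp
  have "\<exists>g \<in> borel_measurable borel. \<forall>\<omega>\<in>space M. real_cond_exp M F (\<lambda>\<omega>. Z \<omega> $ i) \<omega> = g (W \<omega>)" for i
    using factor_through_vimage_algebra_real[of W "space M" borel "real_cond_exp M F (\<lambda>\<omega>. Z \<omega> $ i)"]
      borel_measurable_cond_exp[of M F]
    unfolding F_def by simp
  then obtain G where G[measurable]: "\<And>i. G i \<in> borel_measurable borel"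
    and GW: "\<And>i \<omega>. \<omega> \<in> space M \<Longrightarrow> real_cond_exp M F (\<lambda>\<omega>. Z \<omega> $ i) \<omega> = G i (W \<omega>)"
    by metis
  define g where "g x = (\<chi> i. G i x)" for x
  have Zi: "integrable M (\<lambda>\<omega>. Z \<omega> $ i)" for i
    using Z unfolding integrable_vec_iff by blast
  have *: "integrable M (\<lambda>\<omega>. \<phi> (W \<omega>) * G i (W \<omega>))"
    "(\<integral>\<omega>. \<phi> (W \<omega>) * G i (W \<omega>) \<partial>M) = (\<integral>\<omega>. \<phi> (W \<omega>) * Z \<omega> $ i \<partial>M)"
    if \<phi>: "test_function \<phi>" for \<phi> i
  proof -
    have [measurable]: "\<phi> \<in> borel_measurable borel"
      using test_functionD(1)[OF \<phi>] by (rule borel_measurable_continuous_onI)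
    have int: "integrable M (\<lambda>\<omega>. \<phi> (W \<omega>) * Z \<omega> $ i)"
      using integrable_test_function_scaleR[OF \<phi> W Zi] by simp
    \<comment> \<open>The factor \<open>\<phi> (W \<omega>)\<close> is measurable for
      \<open>F\<close>, as the pull-out rule \<open>real_cond_exp_intg\<close> requires.\<close>
    have "integrable M (\<lambda>\<omega>. \<phi> (W \<omega>) * real_cond_exp M F (\<lambda>\<omega>. Z \<omega> $ i) \<omega>)"
      using Zi[of i] by (intro real_cond_exp_intg(1) int) auto
    moreover have "integrable M (\<lambda>\<omega>. \<phi> (W \<omega>) * real_cond_exp M F (\<lambda>\<omega>. Z \<omega> $ i) \<omega>) \<longleftrightarrow>
        integrable M (\<lambda>\<omega>. \<phi> (W \<omega>) * G i (W \<omega>))"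
      by (intro Bochner_Integration.integrable_cong) (auto simp: GW)
    ultimately show "integrable M (\<lambda>\<omega>. \<phi> (W \<omega>) * G i (W \<omega>))"
      by simp
    have "(\<integral>\<omega>. \<phi> (W \<omega>) * G i (W \<omega>) \<partial>M) = (\<integral>\<omega>. \<phi> (W \<omega>) * real_cond_exp M F (\<lambda>\<omega>. Z \<omega> $ i) \<omega> \<partial>M)"
      by (intro Bochner_Integration.integral_cong) (auto simp: GW)
    also have "\<dots> = (\<integral>\<omega>. \<phi> (W \<omega>) * Z \<omega> $ i \<partial>M)"
      using Zi[of i] by (intro real_cond_exp_intg(2) int) auto
    finally show "(\<integral>\<omega>. \<phi> (W \<omega>) * G i (W \<omega>) \<partial>M) = (\<integral>\<omega>. \<phi> (W \<omega>) * Z \<omega> $ i \<partial>M)" .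
  qed
  show thesis
  proof (rule that)
    show "g \<in> borel_measurable borel"
      unfolding borel_measurable_vec_nth_iff by (simp add: g_def G)
    show "cond_exp_given M W Z \<omega> = g (W \<omega>)" if "\<omega> \<in> space M" for \<omega>
      using GW[OF that] by (simp add: cond_exp_given_def g_def F_def)
    fix \<phi> :: "real ^ 'd \<Rightarrow> real"
    assume \<phi>: "test_function \<phi>"
    show int: "integrable M (\<lambda>\<omega>. \<phi> (W \<omega>) *\<^sub>R g (W \<omega>))"
      unfolding integrable_vec_iff by (simp add: g_def *[OF \<phi>])
    show "(\<integral>\<omega>. \<phi> (W \<omega>) *\<^sub>R g (W \<omega>) \<partial>M) = (\<integral>\<omega>. \<phi> (W \<omega>) *\<^sub>R Z \<omega> \<partial>M)"
      unfolding vec_eq_iff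
      using integral_vec_nth[OF int] integral_vec_nth[OF integrable_test_function_scaleR[OF \<phi> W Z]] *(2)[OF \<phi>]
      by (simp add: g_def)
  qed
qed

section \<open>Score and Stein identities for a linear combination\<close>

text \<open>The factor \<open>b\<close> is the chain rule for \<open>\<phi> (a x + b y)\<close> in
  the variable y. The version with \<open>x\<close> frozen is exported too, because a Stein matrix
  evaluated at \<open>x\<close> can be moved through it as a constant matrix.\<close>

lemma (in prob_space) score_of_linear_combination:
  fixes X Y :: "'a \<Rightarrow> real ^ 'd::finite"
  assumes ind: "indep_var borel X borel Y" and score: "is_score M Y \<rho>"
    and int: "integrable M (\<lambda>\<omega>. \<rho> (Y \<omega>))" and "b \<noteq> 0" and \<phi>: "test_function \<phi>"
  shows "(\<integral>\<omega>. \<phi> (a *\<^sub>R X \<omega> + b *\<^sub>R Y \<omega>) *\<^sub>R \<rho> (Y \<omega>) \<partial>M) =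
    - b *\<^sub>R (\<integral>\<omega>. grad \<phi> (a *\<^sub>R X \<omega> + b *\<^sub>R Y \<omega>) \<partial>M)"
    and "(\<integral>\<omega>'. \<phi> (a *\<^sub>R x + b *\<^sub>R Y \<omega>') *\<^sub>R \<rho> (Y \<omega>') \<partial>M) =
    - b *\<^sub>R (\<integral>\<omega>'. grad \<phi> (a *\<^sub>R x + b *\<^sub>R Y \<omega>') \<partial>M)"
proof -
  have [measurable]: "random_variable borel X" "random_variable borel Y"
    using ind by (auto dest: indep_var_rv1 indep_var_rv2)
  have [measurable]: "\<phi> \<in> borel_measurable borel" "grad \<phi> \<in> borel_measurable borel" "\<rho> \<in> borel_measurable borel"
    using test_functionD(1,3)[OF \<phi>] score by (auto simp: is_score_def intro!: borel_measurable_continuous_onI)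
  show inner: "(\<integral>\<omega>'. \<phi> (a *\<^sub>R x + b *\<^sub>R Y \<omega>') *\<^sub>R \<rho> (Y \<omega>') \<partial>M) =
    - b *\<^sub>R (\<integral>\<omega>'. grad \<phi> (a *\<^sub>R x + b *\<^sub>R Y \<omega>') \<partial>M)" for x
    using is_scoreD[OF score test_function_affine_compose[OF \<phi> \<open>b \<noteq> 0\<close>, of "a *\<^sub>R x"]]
    by (simp add: grad_affine_compose[OF \<phi>])
  have "(\<integral>\<omega>. \<phi> (a *\<^sub>R X \<omega> + b *\<^sub>R Y \<omega>) *\<^sub>R \<rho> (Y \<omega>) \<partial>M) =
    (\<integral>\<omega>. (\<integral>\<omega>'. \<phi> (a *\<^sub>R X \<omega> + b *\<^sub>R Y \<omega>') *\<^sub>R \<rho> (Y \<omega>') \<partial>M) \<partial>M)"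
    by (rule indep_var_Fubini(1)[OF ind, where g="\<lambda>x y. \<phi> (a *\<^sub>R x + b *\<^sub>R y) *\<^sub>R \<rho> y"])
      (auto intro!: integrable_test_function_scaleR[OF \<phi>] int)
  also have "\<dots> = - b *\<^sub>R (\<integral>\<omega>. (\<integral>\<omega>'. grad \<phi> (a *\<^sub>R X \<omega> + b *\<^sub>R Y \<omega>') \<partial>M) \<partial>M)"
    by (simp add: inner)
  also have "(\<integral>\<omega>. (\<integral>\<omega>'. grad \<phi> (a *\<^sub>R X \<omega> + b *\<^sub>R Y \<omega>') \<partial>M) \<partial>M) =
    (\<integral>\<omega>. grad \<phi> (a *\<^sub>R X \<omega> + b *\<^sub>R Y \<omega>) \<partial>M)"
    by (rule indep_var_Fubini(1)[OF ind, where g="\<lambda>x y. grad \<phi> (a *\<^sub>R x + b *\<^sub>R y)", symmetric])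
      (auto intro!: integrable_grad_test_function[OF \<phi>])
  finally show "(\<integral>\<omega>. \<phi> (a *\<^sub>R X \<omega> + b *\<^sub>R Y \<omega>) *\<^sub>R \<rho> (Y \<omega>) \<partial>M) =
    - b *\<^sub>R (\<integral>\<omega>. grad \<phi> (a *\<^sub>R X \<omega> + b *\<^sub>R Y \<omega>) \<partial>M)" .
qed

text \<open>The score of Y creates the gradient that the Stein matrix of X then consumes. The chain
  rule contributes \<open>b\<close> in the first step and \<open>a\<close> in the second, on
  opposite sides of the identities, hence the quotient.\<close>

lemma (in prob_space) stein_matrix_score_product:
  fixes X Y :: "'a \<Rightarrow> real ^ 'd::finite"
  assumes ind: "indep_var borel X borel Y" and "integrable M X"
    and score: "is_score M Y \<rho>" and int_\<rho>: "integrable M (\<lambda>\<omega>. \<rho> (Y \<omega>))"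
    and stein: "is_stein_matrix M X \<tau>" and int_\<tau>: "integrable M (\<lambda>\<omega>. \<tau> (X \<omega>))"
    and "a \<noteq> 0" "b \<noteq> 0" and \<phi>: "test_function \<phi>"
  shows "(\<integral>\<omega>. \<phi> (a *\<^sub>R X \<omega> + b *\<^sub>R Y \<omega>) *\<^sub>R (\<tau> (X \<omega>) *v \<rho> (Y \<omega>)) \<partial>M) =
    - (b / a) *\<^sub>R (\<integral>\<omega>. \<phi> (a *\<^sub>R X \<omega> + b *\<^sub>R Y \<omega>) *\<^sub>R X \<omega> \<partial>M)"
proof -
  let ?W = "\<lambda>x y. a *\<^sub>R x + b *\<^sub>R y"
  have [measurable]: "random_variable borel X" "random_variable borel Y"
    using ind by (auto dest: indep_var_rv1 indep_var_rv2)
  have [measurable]: "\<phi> \<in> borel_measurable borel" "grad \<phi> \<in> borel_measurable borel"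
    "\<rho> \<in> borel_measurable borel" "\<tau> \<in> borel_measurable borel"
    using test_functionD(1,3)[OF \<phi>] score stein
    by (auto simp: is_score_def is_stein_matrix_def intro!: borel_measurable_continuous_onI)
  have int_\<tau>\<rho>: "integrable M (\<lambda>\<omega>. \<phi> (?W (X \<omega>) (Y \<omega>)) *\<^sub>R (\<tau> (X \<omega>) *v \<rho> (Y \<omega>)))"
    by (intro integrable_test_function_scaleR[OF \<phi>] integrable_indep_matrix_vector_mult[OF ind] int_\<tau> int_\<rho>) measurable
  \<comment> \<open>The clause in \<open>is_stein_matrix\<close> covers functions of
    \<open>X\<close> alone; for the joint integrand the bound is the norm of
    \<open>\<tau> (X \<omega>)\<close> times a bound on the gradient.\<close>
  have int_grad: "integrable M (\<lambda>\<omega>. \<tau> (X \<omega>) *v grad \<phi> (?W (X \<omega>) (Y \<omega>)))"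
  proof -
    obtain K where K: "0 \<le> K" "\<And>(A :: real ^ 'd ^ 'd) x. norm (A *v x) \<le> norm A * norm x * K"
      using bounded_bilinear.nonneg_bounded[OF bounded_bilinear_matrix_vector_mult] by blast
    obtain B where B: "\<And>x. norm (grad \<phi> x) \<le> B"
      using test_function_bounded(2)[OF \<phi>] by (auto simp: bounded_iff)
    have "integrable M (\<lambda>\<omega>. norm (\<tau> (X \<omega>)) * B * K)"
      using int_\<tau> by simp
    then show ?thesis
    proof (rule Bochner_Integration.integrable_bound)
      show "AE \<omega> in M. norm (\<tau> (X \<omega>) *v grad \<phi> (?W (X \<omega>) (Y \<omega>))) \<le> norm (norm (\<tau> (X \<omega>)) * B * K)"
      proof (rule AE_I2)
        fix \<omega>
        have "norm (\<tau> (X \<omega>) *v grad \<phi> (?W (X \<omega>) (Y \<omega>))) \<le> norm (\<tau> (X \<omega>)) * norm (grad \<phi> (?W (X \<omega>) (Y \<omega>))) * K"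
          by (rule K)
        also have "\<dots> \<le> norm (\<tau> (X \<omega>)) * B * K"
          by (intro mult_right_mono mult_left_mono B K) simp
        also have "\<dots> \<le> norm (norm (\<tau> (X \<omega>)) * B * K)"
          by simp
        finally show "norm (\<tau> (X \<omega>) *v grad \<phi> (?W (X \<omega>) (Y \<omega>))) \<le> norm (norm (\<tau> (X \<omega>)) * B * K)" .
      qed
    qed measurable
  qed
  \<comment> \<open>\<open>A\<close> stands for \<open>\<tau> (X \<omega>)\<close>, which is
    constant while the integral runs over Y.\<close>
  have inner_score: "(\<integral>\<omega>'. \<phi> (?W x (Y \<omega>')) *\<^sub>R (A *v \<rho> (Y \<omega>')) \<partial>M) =
      - b *\<^sub>R (\<integral>\<omega>'. A *v grad \<phi> (?W x (Y \<omega>')) \<partial>M)" for x and A :: "real ^ 'd ^ 'd"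
  proof -
    have "(\<integral>\<omega>'. \<phi> (?W x (Y \<omega>')) *\<^sub>R (A *v \<rho> (Y \<omega>')) \<partial>M) =
        (\<integral>\<omega>'. A *v (\<phi> (?W x (Y \<omega>')) *\<^sub>R \<rho> (Y \<omega>')) \<partial>M)"
      by (simp add: matrix_vector_mult_scaleR)
    also have "\<dots> = A *v (\<integral>\<omega>'. \<phi> (?W x (Y \<omega>')) *\<^sub>R \<rho> (Y \<omega>') \<partial>M)"
      by (intro integral_bounded_linear matrix_vector_mul_bounded_linear
          integrable_test_function_scaleR[OF \<phi>] int_\<rho>) measurable
    also have "\<dots> = - b *\<^sub>R (A *v (\<integral>\<omega>'. grad \<phi> (?W x (Y \<omega>')) \<partial>M))"
      by (simp only: score_of_linear_combination(2)[OF ind score int_\<rho> \<open>b \<noteq> 0\<close> \<phi>] matrix_vector_mult_scaleR)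
    also have "A *v (\<integral>\<omega>'. grad \<phi> (?W x (Y \<omega>')) \<partial>M) = (\<integral>\<omega>'. A *v grad \<phi> (?W x (Y \<omega>')) \<partial>M)"
      by (intro integral_bounded_linear[symmetric] matrix_vector_mul_bounded_linear
          integrable_grad_test_function[OF \<phi>]) measurable
    finally show ?thesis .
  qed
  have inner_stein: "(\<integral>\<omega>. \<tau> (X \<omega>) *v grad \<phi> (?W (X \<omega>) y) \<partial>M) =
      (1 / a) *\<^sub>R (\<integral>\<omega>. \<phi> (?W (X \<omega>) y) *\<^sub>R X \<omega> \<partial>M)" for y
  proof -
    have "(\<integral>\<omega>. a *\<^sub>R (\<tau> (X \<omega>) *v grad \<phi> (?W (X \<omega>) y)) \<partial>M) = (\<integral>\<omega>. \<phi> (?W (X \<omega>) y) *\<^sub>R X \<omega> \<partial>M)"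
      using is_stein_matrixD[OF stein test_function_affine_compose[OF \<phi> \<open>a \<noteq> 0\<close>, of "b *\<^sub>R y"]]
      by (simp add: grad_affine_compose[OF \<phi>] matrix_vector_mult_scaleR add.commute[of "a *\<^sub>R _" "b *\<^sub>R y"] del: integral_scaleR_right)
    then have *: "a *\<^sub>R (\<integral>\<omega>. \<tau> (X \<omega>) *v grad \<phi> (?W (X \<omega>) y) \<partial>M) = (\<integral>\<omega>. \<phi> (?W (X \<omega>) y) *\<^sub>R X \<omega> \<partial>M)"
      by (simp only: integral_scaleR_right)
    then show ?thesis using \<open>a \<noteq> 0\<close> by (simp flip: *)
  qed
  have "(\<integral>\<omega>. \<phi> (?W (X \<omega>) (Y \<omega>)) *\<^sub>R (\<tau> (X \<omega>) *v \<rho> (Y \<omega>)) \<partial>M) =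
      (\<integral>\<omega>. (\<integral>\<omega>'. \<phi> (?W (X \<omega>) (Y \<omega>')) *\<^sub>R (\<tau> (X \<omega>) *v \<rho> (Y \<omega>')) \<partial>M) \<partial>M)"
    by (rule indep_var_Fubini(1)[OF ind, where g="\<lambda>x y. \<phi> (?W x y) *\<^sub>R (\<tau> x *v \<rho> y)"])
      (measurable, rule int_\<tau>\<rho>)
  also have "\<dots> = - b *\<^sub>R (\<integral>\<omega>. (\<integral>\<omega>'. \<tau> (X \<omega>) *v grad \<phi> (?W (X \<omega>) (Y \<omega>')) \<partial>M) \<partial>M)"
    by (simp only: inner_score integral_scaleR_right)
  also have "(\<integral>\<omega>. (\<integral>\<omega>'. \<tau> (X \<omega>) *v grad \<phi> (?W (X \<omega>) (Y \<omega>')) \<partial>M) \<partial>M) =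
      (\<integral>\<omega>. \<tau> (X \<omega>) *v grad \<phi> (?W (X \<omega>) (Y \<omega>)) \<partial>M)"
    by (rule indep_var_Fubini(1)[OF ind, where g="\<lambda>x y. \<tau> x *v grad \<phi> (?W x y)", symmetric])
      (measurable, rule int_grad)
  \<comment> \<open>The joint integral is reopened in the other order: X is now the inner variable,
    so its Stein identity becomes applicable.\<close>
  also have "\<dots> = (\<integral>\<omega>'. (\<integral>\<omega>. \<tau> (X \<omega>) *v grad \<phi> (?W (X \<omega>) (Y \<omega>')) \<partial>M) \<partial>M)"
    by (rule indep_var_Fubini(2)[OF ind, where g="\<lambda>x y. \<tau> x *v grad \<phi> (?W x y)"])
      (measurable, rule int_grad)
  also have "\<dots> = (1 / a) *\<^sub>R (\<integral>\<omega>'. (\<integral>\<omega>. \<phi> (?W (X \<omega>) (Y \<omega>')) *\<^sub>R X \<omega> \<partial>M) \<partial>M)"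
    by (simp only: inner_stein integral_scaleR_right)
  also have "(\<integral>\<omega>'. (\<integral>\<omega>. \<phi> (?W (X \<omega>) (Y \<omega>')) *\<^sub>R X \<omega> \<partial>M) \<partial>M) = (\<integral>\<omega>. \<phi> (?W (X \<omega>) (Y \<omega>)) *\<^sub>R X \<omega> \<partial>M)"
    by (rule indep_var_Fubini(2)[OF ind, where g="\<lambda>x y. \<phi> (?W x y) *\<^sub>R x", symmetric])
      (measurable, intro integrable_test_function_scaleR[OF \<phi>] assms, measurable)
  finally show ?thesis by simp
qed

text \<open>The existence clause keeps the second conjunct from being vacuous. Integrability of the
  scores and Stein matrices is assumed separately because their definitions give it only against
  test functions; it makes the conditioned variable integrable.\<close>

theorem mainTheorem1:
  fixes M :: "'a measure"
    and X Y W :: "'a \<Rightarrow> real ^ 'd::finite"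
    and fX fY :: "real ^ 'd \<Rightarrow> ennreal"
    and \<rho>X \<rho>Y :: "real ^ 'd \<Rightarrow> real ^ 'd"
    and \<tau>X \<tau>Y :: "real ^ 'd \<Rightarrow> real ^ 'd ^ 'd"
    and \<Gamma> :: "real ^ 'd ^ 'd"
    and t :: real
  assumes "prob_space M"
    and "prob_space.indep_var M borel X borel Y"
    and "finite_covariance M X" and "finite_covariance M Y"
    and "(\<integral>\<omega>. X \<omega> \<partial>M) = 0" and "(\<integral>\<omega>. Y \<omega> \<partial>M) = 0"
    and "distributed M lborel X fX" and "distributed M lborel Y fY"
    and "is_score M X \<rho>X" and "integrable M (\<lambda>\<omega>. \<rho>X (X \<omega>))"
    and "is_score M Y \<rho>Y" and "integrable M (\<lambda>\<omega>. \<rho>Y (Y \<omega>))"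
    and "is_stein_matrix M X \<tau>X" and "integrable M (\<lambda>\<omega>. \<tau>X (X \<omega>))"
    and "is_stein_matrix M Y \<tau>Y" and "integrable M (\<lambda>\<omega>. \<tau>Y (Y \<omega>))"
    and "0 < t" and "t < 1"
    and "W = (\<lambda>\<omega>. sqrt t *\<^sub>R X \<omega> + sqrt (1 - t) *\<^sub>R Y \<omega>)"
    and "\<Gamma> = covariance_matrix M W"
  shows "(\<exists>\<rho>W. is_score M W \<rho>W) \<and>
    (\<forall>\<rho>W. is_score M W \<rho>W \<longrightarrow>
      (AE \<omega> in M. \<rho>W (W \<omega>) + matrix_inv \<Gamma> *v W \<omega> =
        cond_exp_given M W
          (\<lambda>\<omega>. (t / sqrt (1 - t)) *\<^sub>R ((mat 1 - matrix_inv \<Gamma> ** \<tau>X (X \<omega>)) *v \<rho>Y (Y \<omega>))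
             + ((1 - t) / sqrt t) *\<^sub>R ((mat 1 - matrix_inv \<Gamma> ** \<tau>Y (Y \<omega>)) *v \<rho>X (X \<omega>))) \<omega>))"
proof -
  interpret prob_space M by fact
  note ind = assms(2)
  note ind' = indep_var_commute[OF ind]
  define G where "G = matrix_inv \<Gamma>"
  define a where "a = sqrt t"
  define b where "b = sqrt (1 - t)"
  have ab: "a \<noteq> 0" "b \<noteq> 0" "t = a * a" "1 - t = b * b" "a * a + b * b = 1"
    using \<open>0 < t\<close> \<open>t < 1\<close> by (auto simp: a_def b_def)
  have W_eq: "W = (\<lambda>\<omega>. a *\<^sub>R X \<omega> + b *\<^sub>R Y \<omega>)"
    using assms by (simp add: a_def b_def)
  have [measurable]: "random_variable borel X" "random_variable borel Y"
    using ind by (auto dest: indep_var_rv1 indep_var_rv2)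
  have W[measurable]: "random_variable borel W"
    unfolding W_eq by measurable
  have int_X: "integrable M X" and int_Y: "integrable M Y"
    by (auto intro: integrable_if_finite_covariance assms)
  then have int_W: "integrable M W"
    unfolding W_eq by simp
  have meas: "\<tau>X \<in> borel_measurable borel" "\<tau>Y \<in> borel_measurable borel"
    "\<rho>X \<in> borel_measurable borel" "\<rho>Y \<in> borel_measurable borel"
    using assms by (auto simp: is_score_def is_stein_matrix_def)
  define U where "U \<omega> = \<tau>X (X \<omega>) *v \<rho>Y (Y \<omega>)" for \<omega>
  define V where "V \<omega> = \<tau>Y (Y \<omega>) *v \<rho>X (X \<omega>)" for \<omega>
  have int_U: "integrable M U" and int_V: "integrable M V"
    unfolding U_def[abs_def] V_def[abs_def]
    by (intro integrable_indep_matrix_vector_mult[OF ind] integrable_indep_matrix_vector_mult[OF ind'] meas assms)+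
  define R where "R \<omega> = (a * a / b) *\<^sub>R (\<rho>Y (Y \<omega>) - G *v U \<omega>) + (b * b / a) *\<^sub>R (\<rho>X (X \<omega>) - G *v V \<omega>)" for \<omega>
  have R_eq: "(\<lambda>\<omega>. (t / sqrt (1 - t)) *\<^sub>R ((mat 1 - matrix_inv \<Gamma> ** \<tau>X (X \<omega>)) *v \<rho>Y (Y \<omega>))
             + ((1 - t) / sqrt t) *\<^sub>R ((mat 1 - matrix_inv \<Gamma> ** \<tau>Y (Y \<omega>)) *v \<rho>X (X \<omega>))) = R"
    unfolding R_def[abs_def] U_def V_def G_def[symmetric] a_def[symmetric] b_def[symmetric]
    \<comment> \<open>The order matters: \<open>1 - t\<close> must become \<open>b * b\<close>
      before \<open>t\<close> is replaced by \<open>a * a\<close>, which would destroy the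
      pattern.\<close>
    by (simp only: ab(4)) (simp only: ab(3) matrix_vector_mult_diff_rdistrib matrix_vector_mul_lid matrix_vector_mul_assoc)
  have int_G: "integrable M (\<lambda>\<omega>. G *v Z \<omega>)" if "integrable M Z" for Z
    by (rule integrable_bounded_linear[OF matrix_vector_mul_bounded_linear that])
  have int_R: "integrable M R"
    unfolding R_def[abs_def]
    by (intro Bochner_Integration.integrable_add Bochner_Integration.integrable_diff
        integrable_scaleR_right int_G int_U int_V assms)
  have key: "(\<integral>\<omega>. \<phi> (W \<omega>) *\<^sub>R R \<omega> \<partial>M) =
      - (\<integral>\<omega>. grad \<phi> (W \<omega>) \<partial>M) + (\<integral>\<omega>. \<phi> (W \<omega>) *\<^sub>R (G *v W \<omega>) \<partial>M)"
    if \<phi>: "test_function \<phi>" for \<phi>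
  proof -
    note int_\<phi> = integrable_test_function_scaleR[OF \<phi> W]
    define E where "E Z = (\<integral>\<omega>. \<phi> (W \<omega>) *\<^sub>R Z \<omega> \<partial>M)" for Z :: "'a \<Rightarrow> real ^ 'd"
    have E_add: "E (\<lambda>\<omega>. Z \<omega> + Z' \<omega>) = E Z + E Z'" if "integrable M Z" "integrable M Z'" for Z Z'
      unfolding E_def scaleR_add_right by (intro Bochner_Integration.integral_add int_\<phi> that)
    have E_diff: "E (\<lambda>\<omega>. Z \<omega> - Z' \<omega>) = E Z - E Z'" if "integrable M Z" "integrable M Z'" for Z Z'
      unfolding E_def scaleR_diff_right by (intro Bochner_Integration.integral_diff int_\<phi> that)
    have E_scale: "E (\<lambda>\<omega>. c *\<^sub>R Z \<omega>) = c *\<^sub>R E Z" for c Z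
      unfolding E_def by (subst integral_scaleR_right[symmetric]) (simp add: mult.commute)
    have E_G: "E (\<lambda>\<omega>. G *v Z \<omega>) = G *v E Z" if "integrable M Z" for Z
      unfolding E_def matrix_vector_mult_scaleR[symmetric]
      by (intro integral_bounded_linear matrix_vector_mul_bounded_linear int_\<phi> that)
    let ?g = "\<integral>\<omega>. grad \<phi> (W \<omega>) \<partial>M"
    \<comment> \<open>With the summands swapped, the lemmas for X and Y apply verbatim to the
      exchanged pair through \<open>ind'\<close>.\<close>
    have W_eq': "W = (\<lambda>\<omega>. b *\<^sub>R Y \<omega> + a *\<^sub>R X \<omega>)"
      by (simp add: W_eq add.commute)
    have EY: "E (\<lambda>\<omega>. \<rho>Y (Y \<omega>)) = - b *\<^sub>R ?g"
      unfolding E_def W_eq by (rule score_of_linear_combination(1)[OF ind]) (fact assms ab \<phi>)+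
    have EX: "E (\<lambda>\<omega>. \<rho>X (X \<omega>)) = - a *\<^sub>R ?g"
      unfolding E_def W_eq' by (rule score_of_linear_combination(1)[OF ind']) (fact assms ab \<phi>)+
    have EU: "E U = - (b / a) *\<^sub>R E X"
      unfolding E_def W_eq U_def by (rule stein_matrix_score_product[OF ind]) (fact assms ab \<phi> int_X)+
    have EV: "E V = - (a / b) *\<^sub>R E Y"
      unfolding E_def W_eq' V_def by (rule stein_matrix_score_product[OF ind']) (fact assms ab \<phi> int_Y)+
    have EW: "E W = a *\<^sub>R E X + b *\<^sub>R E Y"
      by (subst W_eq) (simp add: E_add E_scale int_X int_Y)
    have "E R = (a * a / b) *\<^sub>R (E (\<lambda>\<omega>. \<rho>Y (Y \<omega>)) - G *v E U) + (b * b / a) *\<^sub>R (E (\<lambda>\<omega>. \<rho>X (X \<omega>)) - G *v E V)"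
      unfolding R_def[abs_def]
      by (simp add: E_add E_scale E_diff E_G int_G int_U int_V assms)
    \<comment> \<open>The weights cancel the chain-rule factors: (a^2 / b) b + (b^2 / a) a = a^2 +
      b^2, while (a^2 / b) (b / a) = a and (b^2 / a) (a / b) = b.\<close>
    also have "\<dots> = - (a * a + b * b) *\<^sub>R ?g + G *v (a *\<^sub>R E X + b *\<^sub>R E Y)"
      using ab(1,2)
      by (simp add: EX EY EU EV matrix_vector_mult_scaleR matrix_vector_right_distrib scaleR_diff_right
          linear_neg[OF matrix_vector_mul_linear] scaleR_add_left scaleR_diff_left)
    also have "\<dots> = - ?g + E (\<lambda>\<omega>. G *v W \<omega>)"
      by (simp add: ab E_G[OF int_W] EW)
    finally show ?thesis unfolding E_def .
  qed
  obtain g where g: "g \<in> borel_measurable borel"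
    "\<And>\<omega>. \<omega> \<in> space M \<Longrightarrow> cond_exp_given M W R \<omega> = g (W \<omega>)"
    "\<And>\<phi>. test_function \<phi> \<Longrightarrow> integrable M (\<lambda>\<omega>. \<phi> (W \<omega>) *\<^sub>R g (W \<omega>))"
    "\<And>\<phi>. test_function \<phi> \<Longrightarrow>
      (\<integral>\<omega>. \<phi> (W \<omega>) *\<^sub>R g (W \<omega>) \<partial>M) = (\<integral>\<omega>. \<phi> (W \<omega>) *\<^sub>R R \<omega> \<partial>M)"
    using cond_exp_given_factor[OF W int_R] by blast
  have score: "is_score M W (\<lambda>x. g x - G *v x)"
    unfolding is_score_def
  proof (intro conjI allI impI)
    show "(\<lambda>x. g x - G *v x) \<in> borel_measurable borel"
      using g(1) by measurable
    fix \<phi> :: "real ^ 'd \<Rightarrow> real"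
    assume \<phi>: "test_function \<phi>"
    note ints = g(3)[OF \<phi>] integrable_test_function_scaleR[OF \<phi> W int_G[OF int_W]]
    show "integrable M (\<lambda>\<omega>. \<phi> (W \<omega>) *\<^sub>R (g (W \<omega>) - G *v W \<omega>))"
      unfolding scaleR_diff_right by (intro Bochner_Integration.integrable_diff ints)
    show "(\<integral>\<omega>. \<phi> (W \<omega>) *\<^sub>R (g (W \<omega>) - G *v W \<omega>) \<partial>M) = - (\<integral>\<omega>. grad \<phi> (W \<omega>) \<partial>M)"
      unfolding scaleR_diff_right Bochner_Integration.integral_diff[OF ints] g(4)[OF \<phi>] key[OF \<phi>] by simp
  qed
  \<comment> \<open>Uniqueness carries the formula from the constructed score to an arbitrary one;
    \<open>AE_space\<close> enters because the factorisation by \<open>g\<close> is stated on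
    \<open>space M\<close>.\<close>
  have "AE \<omega> in M. \<rho>W (W \<omega>) + G *v W \<omega> = cond_exp_given M W R \<omega>" if "is_score M W \<rho>W" for \<rho>W
    using is_score_unique[OF W that score] AE_space
    by eventually_elim (simp add: g(2))
  with score show ?thesis unfolding R_eq G_def by blast
qed

end
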